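(* Let $(V_1,V_2)$ be a pair of twisted isometries with respect to a twist $U$ on a complex separable Hilbert space $\mathcal{H}$, and let $\mathcal{W}_i=\mathcal{H}\ominus V_i\mathcal{H}$ for $i=1,2$. Then the following are equivalent: \begin{enumerate} \item $(V_1,V_2)$ is doubly twisted with respect to the same twist $U$; \item $V_1\mathcal{W}_2\subseteq\mathcal{W}_2$; \item $V_2\mathcal{W}_1\subseteq\mathcal{W}_1$. \end{enumerate}
   Context: A pair $(T_1,T_2)$ of bounded operators on $\mathcal{H}$ is called twisted with respect to a unitary operator $U$ on $\mathcal{H}$ (a twist) if $T_1T_2=UT_2T_1$ and $T_iU=UT_i$ for $i=1,2$; it is called doubly twisted with respect to $U$ if in addition $T_1^*T_2=U^*T_2T_1^*$. *)

theory Defs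
  imports "HOL-Analysis.Analysis"
begin

text \<open>
  Complex Hilbert spaces. The class extends \<^class>\<open>banach\<close>, so norm, topology and completeness are
  those of the library. The inner product is linear in its first argument; positivity and
  definiteness follow from \<open>cinner_norm_sq\<close>.
\<close>

class complex_hilbert_space = banach +
  fixes scaleC :: "complex \<Rightarrow> 'a \<Rightarrow> 'a"  (infixr \<open>*\<^sub>C\<close> 75)
    and cinner :: "'a \<Rightarrow> 'a \<Rightarrow> complex"
  assumes scaleC_add_right: "a *\<^sub>C (x + y) = a *\<^sub>C x + a *\<^sub>C y"
    and scaleC_add_left: "(a + b) *\<^sub>C x = a *\<^sub>C x + b *\<^sub>C x"
    and scaleC_scaleC: "a *\<^sub>C (b *\<^sub>C x) = (a * b) *\<^sub>C x"
    and scaleC_of_real: "complex_of_real r *\<^sub>C x = r *\<^sub>R x"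
    and cinner_commute: "cinner x y = cnj (cinner y x)"
    and cinner_add_left: "cinner (x + y) z = cinner x z + cinner y z"
    and cinner_scaleC_left: "cinner (a *\<^sub>C x) y = a * cinner x y"
    and cinner_norm_sq: "cinner x x = complex_of_real ((norm x)\<^sup>2)"

instantiation complex :: complex_hilbert_space
begin

definition scaleC_complex :: "complex \<Rightarrow> complex \<Rightarrow> complex"
  where "scaleC_complex a x = a * x"

definition cinner_complex :: "complex \<Rightarrow> complex \<Rightarrow> complex"
  where "cinner_complex x y = x * cnj y"

instance
  by standard
    (simp_all add: scaleC_complex_def cinner_complex_def algebra_simps scaleR_conv_of_real
      complex_norm_square del: of_real_power)

end

definition bounded_clinear :: "('a::complex_hilbert_space \<Rightarrow> 'a) \<Rightarrow> bool"
  where "bounded_clinear T \<longleftrightarrow> bounded_linear T \<and> (\<forall>a x. T (a *\<^sub>C x) = a *\<^sub>C T x)"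

text \<open>
  Same shape as the library's \<^const>\<open>adjoint\<close>, for the complex inner product. For bounded operators
  a map as below exists by the Riesz representation theorem; it is unique by \<open>cadjoint_eqI\<close>.
\<close>

definition cadjoint :: "('a::complex_hilbert_space \<Rightarrow> 'a) \<Rightarrow> 'a \<Rightarrow> 'a"
  where "cadjoint T = (SOME S. \<forall>x y. cinner (T x) y = cinner x (S y))"

lemma cinner_left_ext:
  fixes u v :: "'a::complex_hilbert_space"
  assumes "\<And>x. cinner x u = cinner x v"
  shows "u = v"
proof -
  have "cinner u z = cinner v z" for z
    using assms[of z] cinner_commute[of u z] cinner_commute[of v z] by simp
  moreover have "cinner (u - v) z + cinner v z = cinner u z" for z
    using cinner_add_left[of "u - v" v z] by simp
  ultimately have "cinner (u - v) (u - v) = 0"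
    by (metis add_right_cancel add_0)
  then show ?thesis
    by (simp add: cinner_norm_sq)
qed

lemma cadjoint_eqI:
  assumes "\<And>x y. cinner (T x) y = cinner x (S y)"
  shows "cadjoint T = S"
  unfolding cadjoint_def
proof (rule some_equality)
  fix S' assume "\<forall>x y. cinner (T x) y = cinner x (S' y)"
  then show "S' = S"
    using assms by (metis cinner_left_ext ext)
qed (use assms in blast)

definition unitary_operator :: "('a::complex_hilbert_space \<Rightarrow> 'a) \<Rightarrow> bool"
  where "unitary_operator U \<longleftrightarrow>
    bounded_clinear U \<and> cadjoint U \<circ> U = id \<and> U \<circ> cadjoint U = id"

definition isometry_operator :: "('a::complex_hilbert_space \<Rightarrow> 'a) \<Rightarrow> bool"
  where "isometry_operator V \<longleftrightarrow> bounded_clinear V \<and> (\<forall>x. norm (V x) = norm x)"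

definition twisted ::
  "('a::complex_hilbert_space \<Rightarrow> 'a) \<Rightarrow> ('a \<Rightarrow> 'a) \<Rightarrow> ('a \<Rightarrow> 'a) \<Rightarrow> bool"
  where "twisted U T1 T2 \<longleftrightarrow>
    unitary_operator U \<and> bounded_clinear T1 \<and> bounded_clinear T2 \<and>
    T1 \<circ> T2 = U \<circ> T2 \<circ> T1 \<and> T1 \<circ> U = U \<circ> T1 \<and> T2 \<circ> U = U \<circ> T2"

definition doubly_twisted ::
  "('a::complex_hilbert_space \<Rightarrow> 'a) \<Rightarrow> ('a \<Rightarrow> 'a) \<Rightarrow> ('a \<Rightarrow> 'a) \<Rightarrow> bool"
  where "doubly_twisted U T1 T2 \<longleftrightarrow>
    twisted U T1 T2 \<and> cadjoint T1 \<circ> T2 = cadjoint U \<circ> T2 \<circ> cadjoint T1"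

definition ominus ::
  "'a::complex_hilbert_space set \<Rightarrow> 'a set \<Rightarrow> 'a set"  (infixl \<open>\<ominus>\<^sub>H\<close> 65)
  where "M \<ominus>\<^sub>H N = {x \<in> M. \<forall>y\<in>N. cinner x y = 0}"

end

theory Submission
  imports Defs
begin

text \<open>
  The proof rests on the orthogonal decomposition \<open>x = V a + w\<close> with \<open>w \<perp> range V\<close>, available
  for an isometry \<open>V\<close> because its range is complete, hence closed. It yields the adjoint
  \<open>V\<^sup>*\<close> as the map \<open>x \<mapsto> a\<close>, together with \<open>V\<^sup>* V = id\<close> and \<open>W = ker V\<^sup>*\<close>. Because \<open>U\<^sup>*\<close> is the inverse
  of \<open>U\<close>, it commutes with \<open>V\<^sub>1\<close> and \<open>V\<^sub>2\<close> as \<open>U\<close> does.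

  The conditions are linked in a cycle. If \<open>V\<^sub>1 W\<^sub>2 \<subseteq> W\<^sub>2\<close> and \<open>w \<in> W\<^sub>1\<close>, then \<open>V\<^sub>2 w\<close> is tested against
  \<open>V\<^sub>1 x\<close> by splitting \<open>x = V\<^sub>2 a + b\<close>: the \<open>b\<close> part vanishes by hypothesis, and
  \<open>\<langle>V\<^sub>2 w, V\<^sub>1 V\<^sub>2 a\<rangle> = \<langle>V\<^sub>2 w, V\<^sub>2 V\<^sub>1 U a\<rangle> = \<langle>w, V\<^sub>1 U a\<rangle> = 0\<close>; hence \<open>V\<^sub>2 W\<^sub>1 \<subseteq> W\<^sub>1\<close>.
  If \<open>V\<^sub>2 W\<^sub>1 \<subseteq> W\<^sub>1\<close>, then \<open>V\<^sub>1\<^sup>* V\<^sub>2\<close> and \<open>U\<^sup>* V\<^sub>2 V\<^sub>1\<^sup>*\<close> both vanish on \<open>W\<^sub>1\<close>, and they agree on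
  \<open>range V\<^sub>1\<close> by the twisted commutation relation, so they are equal. Finally, if they are equal, then
  \<open>\<langle>V\<^sub>1 w, V\<^sub>2 y\<rangle> = \<langle>w, U\<^sup>* V\<^sub>2 V\<^sub>1\<^sup>* y\<rangle> = \<langle>w, V\<^sub>2 U\<^sup>* V\<^sub>1\<^sup>* y\<rangle> = 0\<close> for \<open>w \<in> W\<^sub>2\<close>.
\<close>

section \<open>Complex inner products\<close>

lemma cinner_add_right: "cinner x (y + z) = cinner x y + cinner x z"
  by (metis cinner_add_left cinner_commute complex_cnj_add)

lemma cinner_scaleC_right: "cinner x (a *\<^sub>C y) = cnj a * cinner x y"
  by (metis cinner_commute cinner_scaleC_left complex_cnj_mult)

lemma cinner_diff_left: "cinner (x - y) z = cinner x z - cinner y z"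
  using cinner_add_left[of "x - y" y z] by simp

lemma cinner_diff_right: "cinner x (y - z) = cinner x y - cinner x z"
  using cinner_add_right[of x "y - z" z] by simp

lemma cinner_zero_left [simp]: "cinner 0 z = 0"
  using cinner_diff_left[of 0 0 z] by simp

lemma cinner_eq_0_commute: "cinner x y = 0 \<longleftrightarrow> cinner y x = 0"
  by (metis cinner_commute complex_cnj_zero)

lemma norm_sq_eq_Re_cinner: "(norm x)\<^sup>2 = Re (cinner x x)"
  by (simp add: cinner_norm_sq del: of_real_power)

lemma norm_add_sq: "(norm (x + y))\<^sup>2 = (norm x)\<^sup>2 + (norm y)\<^sup>2 + 2 * Re (cinner x y)"
proof -
  have "Re (cinner y x) = Re (cinner x y)"
    using arg_cong[OF cinner_commute[of y x], of Re] by simp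
  then show ?thesis
    by (simp add: norm_sq_eq_Re_cinner cinner_add_left cinner_add_right)
qed

lemma norm_diff_sq: "(norm (x - y))\<^sup>2 = (norm x)\<^sup>2 + (norm y)\<^sup>2 - 2 * Re (cinner x y)"
  using norm_add_sq[of "x - y" y]
  by (simp add: cinner_diff_left norm_sq_eq_Re_cinner)

lemma parallelogram_law:
  fixes x y :: "'a::complex_hilbert_space"
  shows "(norm (x + y))\<^sup>2 + (norm (x - y))\<^sup>2 = 2 * (norm x)\<^sup>2 + 2 * (norm y)\<^sup>2"
  by (simp add: norm_add_sq norm_diff_sq)

section \<open>Orthogonal projection onto a closed subspace\<close>

text \<open>
  By the parallelogram law, two points of a convex set that nearly realise the distance to \<open>x\<close> are
  close to each other, since their midpoint is at least as far from \<open>x\<close> as the distance.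
\<close>

lemma dist_sq_le_of_near_minimizers:
  fixes x :: "'a::complex_hilbert_space"
  assumes "convex M" and "u \<in> M" and "v \<in> M"
    and u: "dist x u \<le> infdist x M + e" and v: "dist x v \<le> infdist x M + e" and "0 \<le> e"
  shows "(dist u v)\<^sup>2 \<le> 8 * infdist x M * e + 4 * e\<^sup>2"
proof -
  let ?d = "infdist x M"
  have "midpoint u v \<in> M"
    using convexD[OF assms(1-3), of "1/2" "1/2"] by (simp add: midpoint_def scaleR_add_right)
  then have "?d \<le> dist x (midpoint u v)"
    by (rule infdist_le)
  also have "2 * dist x (midpoint u v) = norm ((x - u) + (x - v))"
  proof -
    have "(x - u) + (x - v) = 2 *\<^sub>R (x - midpoint u v)"
      by (simp add: midpoint_def scaleR_diff_right scaleR_2)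
    then show ?thesis by (simp add: dist_norm)
  qed
  finally have "2 * ?d \<le> norm ((x - u) + (x - v))" by simp
  then have "(2 * ?d)\<^sup>2 \<le> (norm ((x - u) + (x - v)))\<^sup>2"
    by (rule power_mono) (simp add: infdist_nonneg)
  moreover have "(norm (x - u))\<^sup>2 \<le> (?d + e)\<^sup>2" "(norm (x - v))\<^sup>2 \<le> (?d + e)\<^sup>2"
    using u v by (auto intro!: power_mono simp: dist_norm)
  ultimately have "(norm ((x - u) - (x - v)))\<^sup>2 \<le> 4 * (?d + e)\<^sup>2 - (2 * ?d)\<^sup>2"
    using parallelogram_law[of "x - u" "x - v"] by linarith
  also have "4 * (?d + e)\<^sup>2 - (2 * ?d)\<^sup>2 = 8 * ?d * e + 4 * e\<^sup>2"
    by (simp add: power2_eq_square algebra_simps)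
  also have "norm ((x - u) - (x - v)) = dist u v"
    by (simp add: dist_norm norm_minus_commute)
  finally show ?thesis .
qed

text \<open>
  Instead of compactness, completeness supplies the minimizer: any minimizing sequence is Cauchy by
  the preceding estimate.
\<close>

lemma nearest_point_exists:
  fixes x :: "'a::complex_hilbert_space"
  assumes "convex M" and "closed M" and "M \<noteq> {}"
  obtains m where "m \<in> M" and "\<And>u. u \<in> M \<Longrightarrow> dist x m \<le> dist x u"
proof -
  let ?d = "infdist x M"
  have "\<exists>u\<in>M. dist x u \<le> ?d + 1 / real (Suc n)" for n
  proof -
    have "Inf (dist x ` M) < ?d + 1 / real (Suc n)"
      using \<open>M \<noteq> {}\<close> by (simp add: infdist_def)
    then obtain r where "r \<in> dist x ` M" "r < ?d + 1 / real (Suc n)"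
      using \<open>M \<noteq> {}\<close> by (meson cInf_lessD image_is_empty)
    then show ?thesis by (auto intro: less_imp_le)
  qed
  then obtain u where uM: "\<And>n. u n \<in> M" and u: "\<And>n. dist x (u n) \<le> ?d + 1 / real (Suc n)"
    by metis
  have lim: "(\<lambda>n. 1 / real (Suc n)) \<longlonglongrightarrow> 0"
    using LIMSEQ_inverse_real_of_nat by (simp add: inverse_eq_divide)
  have "Cauchy u"
  proof (rule metric_CauchyI)
    fix e :: real assume "0 < e"
    have "(\<lambda>n. 8 * ?d * (1 / real (Suc n)) + 4 * (1 / real (Suc n))\<^sup>2) \<longlonglongrightarrow> 8 * ?d * 0 + 4 * 0\<^sup>2"
      by (intro tendsto_intros lim)
    then have "\<forall>\<^sub>F n in sequentially. 8 * ?d * (1 / real (Suc n)) + 4 * (1 / real (Suc n))\<^sup>2 < e\<^sup>2"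
      using \<open>0 < e\<close> by (intro order_tendstoD(2)) auto
    then obtain N where N: "8 * ?d * (1 / real (Suc N)) + 4 * (1 / real (Suc N))\<^sup>2 < e\<^sup>2"
      using eventually_happens'[OF sequentially_bot] by blast
    have near: "dist x (u n) \<le> ?d + 1 / real (Suc N)" if "N \<le> n" for n
    proof -
      have "1 / real (Suc n) \<le> 1 / real (Suc N)"
        using that by (intro divide_left_mono) auto
      then show ?thesis using u[of n] by linarith
    qed
    have "dist (u m) (u n) < e" if "N \<le> m" "N \<le> n" for m n
    proof -
      have "(dist (u m) (u n))\<^sup>2 < e\<^sup>2"
        using dist_sq_le_of_near_minimizers[OF \<open>convex M\<close> uM uM near[OF that(1)] near[OF that(2)]] N
        by simp
      then show ?thesis
        using \<open>0 < e\<close> by (meson less_imp_le power_less_imp_less_base)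
    qed
    then show "\<exists>N. \<forall>m\<ge>N. \<forall>n\<ge>N. dist (u m) (u n) < e" by blast
  qed
  then obtain m where m: "u \<longlonglongrightarrow> m"
    using Cauchy_convergent convergent_def by blast
  have "m \<in> M"
    using \<open>closed M\<close> uM m closed_sequentially by blast
  have "dist x m \<le> ?d + 0"
    by (rule LIMSEQ_le[OF tendsto_dist[OF tendsto_const m] tendsto_add[OF tendsto_const lim]])
      (use u in blast)
  then show thesis
    using that \<open>m \<in> M\<close> infdist_le[of _ M x] by fastforce
qed

text \<open>
  If \<open>m\<close> is the point of \<open>M\<close> nearest to \<open>x\<close>, moving from \<open>m\<close> along a nonzero \<open>y \<in> M\<close> by the
  Fourier coefficient of \<open>x - m\<close> lowers the squared distance by \<open>|\<langle>x - m, y\<rangle>|\<^sup>2 / |y|\<^sup>2\<close>. By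
  minimality this is zero.
\<close>

lemma orthogonal_decomposition:
  fixes x :: "'a::complex_hilbert_space"
  assumes "closed M" and "0 \<in> M"
    and add: "\<And>u v. u \<in> M \<Longrightarrow> v \<in> M \<Longrightarrow> u + v \<in> M"
    and scale: "\<And>a u. u \<in> M \<Longrightarrow> a *\<^sub>C u \<in> M"
  obtains m where "m \<in> M" and "\<And>y. y \<in> M \<Longrightarrow> cinner (x - m) y = 0"
proof -
  have "convex M"
    unfolding convex_def by (metis add scale scaleC_of_real)
  then obtain m where "m \<in> M" and min: "\<And>u. u \<in> M \<Longrightarrow> dist x m \<le> dist x u"
    using nearest_point_exists \<open>closed M\<close> \<open>0 \<in> M\<close> by (metis empty_iff)
  have "cinner (x - m) y = 0" if "y \<in> M" for y
  proof (cases "y = 0")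
    case True
    then show ?thesis by (simp add: cinner_eq_0_commute[of _ 0])
  next
    case False
    let ?w = "x - m"
    let ?c = "cinner ?w y"
    define t where "t = ?c / complex_of_real ((norm y)\<^sup>2)"
    have "norm ?w \<le> norm (?w - t *\<^sub>C y)"
      using min[OF add[OF \<open>m \<in> M\<close> scale[OF that]], of t]
      by (simp add: dist_norm diff_diff_eq)
    then have "(norm ?w)\<^sup>2 \<le> (norm (?w - t *\<^sub>C y))\<^sup>2"
      by (simp add: power_mono)
    also have "\<dots> = (norm ?w)\<^sup>2 + (cmod t)\<^sup>2 * (norm y)\<^sup>2 - 2 * Re (cnj t * ?c)"
    proof -
      have "cinner (t *\<^sub>C y) (t *\<^sub>C y) = complex_of_real ((cmod t)\<^sup>2 * (norm y)\<^sup>2)"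
        by (simp only: cinner_scaleC_left cinner_scaleC_right cinner_norm_sq[of y]
            of_real_mult complex_norm_square mult_ac)
      then have "(norm (t *\<^sub>C y))\<^sup>2 = (cmod t)\<^sup>2 * (norm y)\<^sup>2"
        by (simp add: norm_sq_eq_Re_cinner[of "t *\<^sub>C y"] del: of_real_power)
      then show ?thesis by (simp add: norm_diff_sq cinner_scaleC_right)
    qed
    also have "cnj t * ?c = complex_of_real ((cmod t)\<^sup>2 * (norm y)\<^sup>2)"
    proof -
      have "?c = t * complex_of_real ((norm y)\<^sup>2)"
        using False by (simp add: t_def)
      then show ?thesis
        by (simp only: of_real_mult complex_norm_square mult_ac)
    qed
    finally have "(cmod t)\<^sup>2 * (norm y)\<^sup>2 \<le> 0"
      by (simp add: mult.commute)
    then have "t = 0"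
      using False by (simp add: mult_le_0_iff)
    then show ?thesis using False by (simp add: t_def)
  qed
  then show thesis using that \<open>m \<in> M\<close> by blast
qed

section \<open>Isometries and their adjoints\<close>

lemma isometry_operator_linear:
  assumes "isometry_operator V"
  shows "V (x + y) = V x + V y" "V (x - y) = V x - V y" "V (a *\<^sub>C x) = a *\<^sub>C V x" "V 0 = 0"
proof -
  have "bounded_linear V" and scaleC: "V (a *\<^sub>C x) = a *\<^sub>C V x"
    using assms by (auto simp: isometry_operator_def bounded_clinear_def)
  interpret bounded_linear V by fact
  show "V (x + y) = V x + V y" "V (x - y) = V x - V y" "V (a *\<^sub>C x) = a *\<^sub>C V x" "V 0 = 0"
    using scaleC by (simp_all add: add diff)
qed

text \<open>Polarization: norms determine real parts, and \<open>\<i> x\<close> in place of \<open>x\<close> gives imaginary parts.\<close>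

lemma isometry_cinner:
  assumes V: "isometry_operator V"
  shows "cinner (V x) (V y) = cinner x y"
proof -
  have norm: "norm (V z) = norm z" for z
    using V by (simp add: isometry_operator_def)
  have Re: "Re (cinner (V z) (V y)) = Re (cinner z y)" for z
    using norm_add_sq[of "V z" "V y"] norm_add_sq[of z y]
    by (simp add: norm flip: isometry_operator_linear(1)[OF V])
  have "Im (cinner (V x) (V y)) = Im (cinner x y)"
    using Re[of "\<i> *\<^sub>C x"] by (simp add: isometry_operator_linear[OF V] cinner_scaleC_left)
  then show ?thesis using Re[of x] by (simp add: complex_eq_iff)
qed

text \<open>An isometry carries completeness of the space over to its range.\<close>

lemma isometry_closed_range:
  assumes V: "isometry_operator V"
  shows "closed (range V)"
proof -
  have "bounded_linear V"
    using V by (simp add: isometry_operator_def bounded_clinear_def)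
  then have "complete (range V)"
    by (rule complete_isometric_image[rotated 2, where e = 1])
      (use V in \<open>auto simp: isometry_operator_def complete_UNIV\<close>)
  then show ?thesis by (rule complete_imp_closed)
qed

lemma wandering_subspace_iff:
  "w \<in> UNIV \<ominus>\<^sub>H range V \<longleftrightarrow> (\<forall>y. cinner w (V y) = 0)"
  by (simp add: ominus_def)

lemma isometry_range_decomposition:
  assumes V: "isometry_operator V"
  obtains a w where "x = V a + w" and "w \<in> UNIV \<ominus>\<^sub>H range V"
proof -
  obtain m where "m \<in> range V" and "\<And>y. y \<in> range V \<Longrightarrow> cinner (x - m) y = 0"
  proof (rule orthogonal_decomposition[OF isometry_closed_range[OF V], of x])
    show "0 \<in> range V"
      by (metis isometry_operator_linear(4)[OF V] rangeI)
    show "u + v \<in> range V" if "u \<in> range V" "v \<in> range V" for u v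
      using that by (auto simp flip: isometry_operator_linear(1)[OF V])
    show "a *\<^sub>C u \<in> range V" if "u \<in> range V" for a u
      using that by (auto simp flip: isometry_operator_linear(3)[OF V])
  qed blast
  then show thesis
    using that[of _ "x - m"] by (auto simp: wandering_subspace_iff)
qed

text \<open>
  Since \<^const>\<open>cadjoint\<close> is a choice, its defining identity needs a witness: the map sending
  \<open>V a + w\<close> to \<open>a\<close>, where \<open>w \<perp> range V\<close>.
\<close>

lemma isometry_cadjoint:
  assumes V: "isometry_operator V"
  shows "cinner (V x) y = cinner x (cadjoint V y)"
proof -
  have "\<exists>a. \<forall>x. cinner (V x) y = cinner x a" for y
  proof -
    obtain a w where "y = V a + w" and "w \<in> UNIV \<ominus>\<^sub>H range V"
      using isometry_range_decomposition[OF V] .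
    then have "cinner (V x) y = cinner x a" for x
      using cinner_eq_0_commute[of "V x" w]
      by (simp add: cinner_add_right isometry_cinner[OF V] wandering_subspace_iff)
    then show ?thesis by blast
  qed
  then obtain S where S: "\<And>x y. cinner (V x) y = cinner x (S y)"
    by metis
  then have "cadjoint V = S"
    by (rule cadjoint_eqI)
  with S show ?thesis by simp
qed

lemma isometry_cadjoint_add:
  assumes "isometry_operator V"
  shows "cadjoint V (x + y) = cadjoint V x + cadjoint V y"
  by (rule cinner_left_ext) (simp add: cinner_add_right flip: isometry_cadjoint[OF assms])

lemma isometry_cadjoint_cancel:
  assumes "isometry_operator V"
  shows "cadjoint V (V x) = x"
  by (rule cinner_left_ext)
    (simp add: isometry_cinner[OF assms] flip: isometry_cadjoint[OF assms])

lemma wandering_subspace_eq_ker_cadjoint: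
  assumes "isometry_operator V"
  shows "w \<in> UNIV \<ominus>\<^sub>H range V \<longleftrightarrow> cadjoint V w = 0"
proof -
  have "w \<in> UNIV \<ominus>\<^sub>H range V \<longleftrightarrow> (\<forall>y. cinner y (cadjoint V w) = 0)"
    by (simp add: wandering_subspace_iff cinner_eq_0_commute[of w] flip: isometry_cadjoint[OF assms])
  also have "\<dots> \<longleftrightarrow> cadjoint V w = 0"
    by (metis cinner_eq_0_commute cinner_left_ext cinner_zero_left)
  finally show ?thesis .
qed

section \<open>Twisted pairs of isometries\<close>

lemma twisted_relations:
  assumes "twisted U V1 V2"
  shows "V1 (V2 x) = U (V2 (V1 x))"
    and "V1 (U x) = U (V1 x)" and "V2 (U x) = U (V2 x)"
    and "cadjoint U (U x) = x" and "U (cadjoint U x) = x"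
  using assms by (simp_all add: twisted_def unitary_operator_def fun_eq_iff)

lemma twisted_cadjoint_commute:
  assumes "twisted U V1 V2"
  shows "V1 (cadjoint U x) = cadjoint U (V1 x)" and "V2 (cadjoint U x) = cadjoint U (V2 x)"
  using twisted_relations[OF assms] by metis+

lemma invariant_wandering_subspace_swap:
  assumes V1: "isometry_operator V1" and V2: "isometry_operator V2" and tw: "twisted U V1 V2"
    and inv: "V1 ` (UNIV \<ominus>\<^sub>H range V2) \<subseteq> UNIV \<ominus>\<^sub>H range V2"
  shows "V2 ` (UNIV \<ominus>\<^sub>H range V1) \<subseteq> UNIV \<ominus>\<^sub>H range V1"
proof (rule image_subsetI)
  fix w assume w: "w \<in> UNIV \<ominus>\<^sub>H range V1"
  have "cinner (V2 w) (V1 x) = 0" for x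
  proof -
    obtain a b where x: "x = V2 a + b" and b: "b \<in> UNIV \<ominus>\<^sub>H range V2"
      using isometry_range_decomposition[OF V2] .
    have "cinner (V2 w) (V1 (V2 a)) = cinner (V2 w) (V2 (V1 (U a)))"
      by (simp add: twisted_relations[OF tw])
    also have "\<dots> = 0"
      using w by (simp only: isometry_cinner[OF V2] wandering_subspace_iff)
    finally have "cinner (V2 w) (V1 (V2 a)) = 0" .
    moreover have "cinner (V2 w) (V1 b) = 0"
      using inv b cinner_eq_0_commute by (fastforce simp: wandering_subspace_iff)
    ultimately show ?thesis
      by (simp add: x isometry_operator_linear(1)[OF V1] cinner_add_right)
  qed
  then show "V2 w \<in> UNIV \<ominus>\<^sub>H range V1"
    by (simp add: wandering_subspace_iff)
qed

lemma doubly_twisted_if_invariant: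
  assumes V1: "isometry_operator V1" and V2: "isometry_operator V2" and tw: "twisted U V1 V2"
    and inv: "V2 ` (UNIV \<ominus>\<^sub>H range V1) \<subseteq> UNIV \<ominus>\<^sub>H range V1"
  shows "doubly_twisted U V1 V2"
proof -
  have "cadjoint V1 (V2 x) = cadjoint U (V2 (cadjoint V1 x))" for x
  proof -
    obtain a w where x: "x = V1 a + w" and w: "w \<in> UNIV \<ominus>\<^sub>H range V1"
      using isometry_range_decomposition[OF V1] .
    have "V2 (V1 a) = V1 (cadjoint U (V2 a))"
      using twisted_relations[OF tw] twisted_cadjoint_commute[OF tw] by metis
    then have "cadjoint V1 (V2 (V1 a)) = cadjoint U (V2 a)"
      by (simp only: isometry_cadjoint_cancel[OF V1])
    moreover have "cadjoint V1 (V2 w) = 0"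
      using inv w wandering_subspace_eq_ker_cadjoint[OF V1] by blast
    moreover have "cadjoint V1 x = a"
      using w by (simp add: x isometry_cadjoint_add[OF V1] isometry_cadjoint_cancel[OF V1]
          wandering_subspace_eq_ker_cadjoint[OF V1])
    ultimately show ?thesis
      by (simp add: x isometry_operator_linear(1)[OF V2] isometry_cadjoint_add[OF V1])
  qed
  then show ?thesis
    using tw by (simp add: doubly_twisted_def fun_eq_iff)
qed

lemma doubly_twisted_imp_invariant:
  assumes V1: "isometry_operator V1" and "doubly_twisted U V1 V2"
  shows "V1 ` (UNIV \<ominus>\<^sub>H range V2) \<subseteq> UNIV \<ominus>\<^sub>H range V2"
proof (rule image_subsetI)
  have tw: "twisted U V1 V2"
    and dt: "cadjoint V1 (V2 y) = cadjoint U (V2 (cadjoint V1 y))" for y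
    using assms(2) by (simp_all add: doubly_twisted_def fun_eq_iff)
  fix w assume w: "w \<in> UNIV \<ominus>\<^sub>H range V2"
  have "cinner (V1 w) (V2 y) = 0" for y
  proof -
    have "cinner (V1 w) (V2 y) = cinner w (V2 (cadjoint U (cadjoint V1 y)))"
      by (simp add: isometry_cadjoint[OF V1] dt twisted_cadjoint_commute(2)[OF tw])
    then show ?thesis using w by (simp add: wandering_subspace_iff)
  qed
  then show "V1 w \<in> UNIV \<ominus>\<^sub>H range V2"
    by (simp add: wandering_subspace_iff)
qed

theorem theorem6p4:
  fixes U V1 V2 :: "'a::complex_hilbert_space \<Rightarrow> 'a" and W1 W2 :: "'a set"
  assumes "separable_space (euclidean :: 'a topology)"
    and "isometry_operator V1" and "isometry_operator V2"
    and "twisted U V1 V2"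
    and "W1 = UNIV \<ominus>\<^sub>H range V1" and "W2 = UNIV \<ominus>\<^sub>H range V2"
  shows "(doubly_twisted U V1 V2 \<longleftrightarrow> V1 ` W2 \<subseteq> W2) \<and>
         (V1 ` W2 \<subseteq> W2 \<longleftrightarrow> V2 ` W1 \<subseteq> W1)"
  using invariant_wandering_subspace_swap[OF assms(2-4)]
    doubly_twisted_if_invariant[OF assms(2-4)] doubly_twisted_imp_invariant[OF assms(2)]
  unfolding assms(5,6) by blast

end
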